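(* Let $\varepsilon\ge0$ and let $G$ be a finite simple undirected graph. The priority function $\rho_{\mathrm{ADG}}$ computed by ADG with parameter $\varepsilon$ is a partial $2(1+\varepsilon)$-approximate degeneracy ordering of $G$.
   Context: The degeneracy $d$ of $G=(V,E)$ is the smallest $s$ such that every nonempty induced subgraph of $G$ has a vertex of degree at most $s$. A partial $k$-approximate degeneracy ordering of $G$ is an assignment of ranks to the vertices (several vertices may have equal rank) such that each vertex has at most $k\cdot d$ neighbors of equal or higher rank. For $U\subseteq V$, $N_U(v)$ denotes the set of neighbors of $v$ in $U$. Algorithm ADG (parameter $\varepsilon$, input $G=(V,E)$). Initialize $U=V$, $D[v]=\deg(v)$ for all $v$, $\ell=1$. While $U\neq\emptyset$: compute $\widehat\delta=\frac1{|U|}\sum_{v\in U}D[v]$; set $R=\{u\in U: D[u]\le(1+\varepsilon)\widehat\delta\}$; for all $v\in R$ and all $u\in N_U(v)$, decrement $D[u]$; set $U=U\setminus R$; set $\rho_{\mathrm{ADG}}(v)=\ell$ for all $v\in R$; set $\ell=\ell+1$. (So at the start of each iteration $D[v]$ is the degree of $v$ in $G[U]$ for $v\in U$.) The output is $\rho_{\mathrm{ADG}}$, where larger values mean higher rank. *)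

theory Defs
  imports
    Complex_Main
    "HOL-Library.While_Combinator"
    "Graph_Theory.Digraph_Component"
begin

text \<open>
  A finite simple undirected graph is a \<open>graph\<close> of \<open>Graph_Theory\<close>: a finite symmetric digraph
  without loops and without parallel arcs. Each undirected edge is a pair of opposite arcs, so the
  undirected degree of a vertex is its \<open>out_degree\<close> (not the sum of its in- and out-degree).
\<close>

definition neighbors_in :: "('a, 'b) pre_digraph \<Rightarrow> 'a set \<Rightarrow> 'a \<Rightarrow> 'a set" where
  "neighbors_in G U v = {u \<in> U. v \<rightarrow>\<^bsub>G\<^esub> u}"

definition degeneracy :: "('a, 'b) pre_digraph \<Rightarrow> nat" where
  "degeneracy G = (LEAST s. \<forall>H. induced_subgraph H G \<and> verts H \<noteq> {} \<longrightarrow>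
     (\<exists>v \<in> verts H. out_degree H v \<le> s))"

definition partial_approx_degeneracy_ordering ::
    "real \<Rightarrow> ('a, 'b) pre_digraph \<Rightarrow> ('a \<Rightarrow> 'r::linorder) \<Rightarrow> bool" where
  "partial_approx_degeneracy_ordering k G \<rho> \<longleftrightarrow>
     (\<forall>v \<in> verts G. real (card {u \<in> neighbors_in G (verts G) v. \<rho> v \<le> \<rho> u})
        \<le> k * real (degeneracy G))"

record 'a adg_state =
  active :: "'a set"
  deg_of :: "'a \<Rightarrow> int"
  level :: nat
  rank_of :: "'a \<Rightarrow> nat"

text \<open>The initial \<open>rank_of\<close> is an arbitrary placeholder for ``not yet assigned''.\<close>

definition adg_init :: "('a, 'b) pre_digraph \<Rightarrow> 'a adg_state" where
  "adg_init G =
     \<lparr>active = verts G, deg_of = (\<lambda>v. int (out_degree G v)), level = 1, rank_of = (\<lambda>_. 0)\<rparr>"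

definition adg_avg :: "'a adg_state \<Rightarrow> real" where
  "adg_avg s = 1 / real (card (active s)) * (\<Sum>v \<in> active s. real_of_int (deg_of s v))"

definition adg_batch :: "real \<Rightarrow> 'a adg_state \<Rightarrow> 'a set" where
  "adg_batch \<epsilon> s = {u \<in> active s. real_of_int (deg_of s u) \<le> (1 + \<epsilon>) * adg_avg s}"

text \<open>
  Decrementing \<open>deg_of u\<close> once for every \<open>v\<close> in the batch \<open>R\<close> and every \<open>u\<close> in the active
  neighborhood of \<open>v\<close> subtracts the number of those \<open>v\<close>, in whatever order this is done. The
  neighborhoods refer to the active set before the batch is removed.
\<close>

definition adg_step :: "real \<Rightarrow> ('a, 'b) pre_digraph \<Rightarrow> 'a adg_state \<Rightarrow> 'a adg_state" where
  "adg_step \<epsilon> G s =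
     (let U = active s; R = adg_batch \<epsilon> s in
      \<lparr>active = U - R,
       deg_of = (\<lambda>u. deg_of s u - int (card {v \<in> R. u \<in> neighbors_in G U v})),
       level = level s + 1,
       rank_of = (\<lambda>v. if v \<in> R then level s else rank_of s v)\<rparr>)"

text \<open>The result is \<^term>\<open>None\<close> iff the loop does not terminate.\<close>

definition adg :: "real \<Rightarrow> ('a, 'b) pre_digraph \<Rightarrow> ('a \<Rightarrow> nat) option" where
  "adg \<epsilon> G =
     map_option rank_of (while_option (\<lambda>s. active s \<noteq> {}) (adg_step \<epsilon> G) (adg_init G))"

end

theory Submission
  imports Defs
begin

text \<open>
  Every nonempty vertex set \<open>U\<close> induces a subgraph with a vertex of degree at most the degeneracy
  \<open>d\<close>; removing such vertices one at a time shows that the degrees in \<open>G[U]\<close> sum to at most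
  \<open>2 d |U|\<close>. Hence every vertex of a batch has at most \<open>(1 + \<epsilon>) * 2 d\<close> neighbors in the active set
  it is removed from, and these are exactly its neighbors of equal or higher rank. A vertex of
  minimum degree has at most average degree, so no batch is empty and the loop terminates.
\<close>

section \<open>Degrees in induced subgraphs\<close>

lemma neighbors_in_subset: "neighbors_in G U v \<subseteq> U"
  by (auto simp: neighbors_in_def)

lemma finite_neighbors_in: "finite U \<Longrightarrow> finite (neighbors_in G U v)"
  using neighbors_in_subset finite_subset by metis

text \<open>\<open>head G\<close> maps the out-arcs of \<open>v\<close> inside \<open>U\<close>
  bijectively onto its neighbors in \<open>U\<close>; injectivity is the absence of parallel
  arcs.\<close>

lemma (in nomulti_digraph) out_degree_induce_subgraph:
  assumes "v \<in> U"
  shows "out_degree (G \<restriction> U) v = card (neighbors_in G U v)"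
proof -
  have "bij_betw (head G) (out_arcs (G \<restriction> U) v) (neighbors_in G U v)"
  proof (rule bij_betwI')
    show "head G x = head G y \<longleftrightarrow> x = y"
      if "x \<in> out_arcs (G \<restriction> U) v" "y \<in> out_arcs (G \<restriction> U) v" for x y
      using that no_multi_arcs[of x y] by (auto simp: arc_to_ends_def)
  qed (use assms in \<open>force simp: neighbors_in_def arcs_ends_conv\<close>)+
  then show ?thesis
    by (simp add: out_degree_def bij_betw_same_card)
qed

lemma (in nomulti_digraph) out_degree_eq_card_neighbors_in:
  assumes "v \<in> verts G"
  shows "out_degree G v = card (neighbors_in G (verts G) v)"
proof -
  have "out_arcs (G \<restriction> verts G) v = out_arcs G v"
    by auto
  then show ?thesis
    using out_degree_induce_subgraph[OF assms] by (simp add: out_degree_def)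
qed

lemma (in fin_digraph) ex_out_degree_le_degeneracy:
  assumes "induced_subgraph H G" "verts H \<noteq> {}"
  shows "\<exists>v \<in> verts H. out_degree H v \<le> degeneracy G"
proof -
  \<comment> \<open>\<open>LEAST\<close> attains its property only if some bound qualifies. The
    total number of arcs does, since every out-arc of \<open>H\<close> is an arc of
    \<open>G\<close>.\<close>
  have "\<forall>H. induced_subgraph H G \<and> verts H \<noteq> {} \<longrightarrow>
      (\<exists>v \<in> verts H. out_degree H v \<le> card (arcs G))"
  proof (intro allI impI)
    fix H assume H: "induced_subgraph H G \<and> verts H \<noteq> {}"
    then have "out_degree H v \<le> card (arcs G)" for v
      unfolding out_degree_def by (intro card_mono) (auto simp: induced_subgraph_def)
    then show "\<exists>v \<in> verts H. out_degree H v \<le> card (arcs G)"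
      using H by blast
  qed
  from LeastI[of "\<lambda>s. \<forall>H. induced_subgraph H G \<and> verts H \<noteq> {} \<longrightarrow>
      (\<exists>v \<in> verts H. out_degree H v \<le> s)", OF this]
  show ?thesis
    using assms by (fold degeneracy_def) blast
qed

section \<open>Degree sums over vertex subsets of an undirected graph\<close>

context graph
begin

lemma dominates_commute: "u \<rightarrow>\<^bsub>G\<^esub> v \<longleftrightarrow> v \<rightarrow>\<^bsub>G\<^esub> u"
  using arcs_ends_symmetric[OF sym_arcs] by blast

lemma ex_card_neighbors_in_le_degeneracy:
  assumes "U \<subseteq> verts G" "U \<noteq> {}"
  shows "\<exists>v \<in> U. card (neighbors_in G U v) \<le> degeneracy G"
  using ex_out_degree_le_degeneracy[of "G \<restriction> U"] induced_induce[of U] assms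
  by (auto simp: out_degree_induce_subgraph)

text \<open>Deleting \<open>v\<close> loses its own term and lowers the term of each of its
  neighbors by one. Both losses equal the degree of \<open>v\<close> in \<open>U\<close>, hence the
  factor 2.\<close>

lemma sum_card_neighbors_in_remove:
  assumes "finite U" "v \<in> U"
  shows "(\<Sum>u\<in>U. card (neighbors_in G U u)) =
    (\<Sum>u\<in>U - {v}. card (neighbors_in G (U - {v}) u)) + 2 * card (neighbors_in G U v)"
proof -
  \<comment> \<open>There are no loops, so \<open>v\<close> is not its own neighbor. Symmetry then
    gives the form with arcs into \<open>v\<close>, which matches the indicator summed
    below.\<close>
  have "neighbors_in G U v = {u \<in> U - {v}. v \<rightarrow>\<^bsub>G\<^esub> u}"
    using adj_not_same by (auto simp: neighbors_in_def)
  then have N: "neighbors_in G U v = {u \<in> U - {v}. u \<rightarrow>\<^bsub>G\<^esub> v}"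
    by (simp only: dominates_commute[of v])
  have "card (neighbors_in G U u) =
      card (neighbors_in G (U - {v}) u) + (if u \<rightarrow>\<^bsub>G\<^esub> v then 1 else 0)" for u
  proof -
    have "neighbors_in G U u =
        (if u \<rightarrow>\<^bsub>G\<^esub> v then insert v (neighbors_in G (U - {v}) u) else neighbors_in G (U - {v}) u)"
      using assms by (auto simp: neighbors_in_def)
    moreover have "v \<notin> neighbors_in G (U - {v}) u"
      by (simp add: neighbors_in_def)
    ultimately show ?thesis
      using assms by (simp add: finite_neighbors_in)
  qed
  then have "(\<Sum>u\<in>U - {v}. card (neighbors_in G U u)) =
      (\<Sum>u\<in>U - {v}. card (neighbors_in G (U - {v}) u)) + card (neighbors_in G U v)"
    using assms by (simp add: N sum.distrib sum.If_cases Int_def conj_commute)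
  then show ?thesis
    using sum.remove[OF assms, of "\<lambda>u. card (neighbors_in G U u)"] by simp
qed

lemma sum_card_neighbors_in_le:
  assumes "U \<subseteq> verts G"
  shows "(\<Sum>v\<in>U. card (neighbors_in G U v)) \<le> 2 * degeneracy G * card U"
proof -
  have "finite U"
    using assms finite_verts finite_subset by blast
  then show ?thesis
    using assms
  proof (induction U rule: finite_remove_induct)
    case (remove U)
    then obtain v where v: "v \<in> U" "card (neighbors_in G U v) \<le> degeneracy G"
      using ex_card_neighbors_in_le_degeneracy by blast
    have "(\<Sum>u\<in>U - {v}. card (neighbors_in G (U - {v}) u)) \<le> 2 * degeneracy G * card (U - {v})"
      using remove v by blast
    moreover have "card U = Suc (card (U - {v}))"
      using card.remove[OF \<open>finite U\<close> v(1)] .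
    ultimately show ?case
      using sum_card_neighbors_in_remove[OF \<open>finite U\<close> v(1)] v(2) by (simp add: algebra_simps)
  qed simp
qed

section \<open>The loop invariant\<close>

text \<open>The counters of removed vertices go stale, so only active vertices are
  constrained.\<close>

definition degs_correct :: "'a adg_state \<Rightarrow> bool" where
  "degs_correct s \<longleftrightarrow> active s \<subseteq> verts G \<and>
     (\<forall>v \<in> active s. deg_of s v = int (card (neighbors_in G (active s) v)))"

lemma finite_active: "degs_correct s \<Longrightarrow> finite (active s)"
  using finite_subset[OF _ finite_verts] by (simp add: degs_correct_def)

text \<open>
  Active vertices count as having higher rank, since they will receive one; this makes the bound for
  a removed vertex invariant.
\<close>

definition ranks_correct :: "real \<Rightarrow> 'a adg_state \<Rightarrow> bool" where
  "ranks_correct K s \<longleftrightarrow> (\<forall>v \<in> verts G - active s. rank_of s v < level s \<and>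
     real (card {u \<in> neighbors_in G (verts G) v. u \<in> active s \<or> rank_of s v \<le> rank_of s u}) \<le> K)"

section \<open>Bounds on the average degree and on the batch\<close>

text \<open>The lower bound ensures that the factor \<open>1 + \<epsilon>\<close> does not push the
  threshold below the average; the upper bound is the degree sum divided by
  \<open>card (active s)\<close>.\<close>

lemma adg_avg_bounds:
  assumes "degs_correct s" "active s \<noteq> {}"
  shows "0 \<le> adg_avg s" "adg_avg s \<le> 2 * real (degeneracy G)"
proof -
  let ?U = "active s"
  have U: "?U \<subseteq> verts G"
    using assms by (simp add: degs_correct_def)
  then have pos: "0 < card ?U"
    using assms finite_active by (simp add: card_gt_0_iff)
  have avg: "adg_avg s = real (\<Sum>v\<in>?U. card (neighbors_in G ?U v)) / real (card ?U)"
    using assms by (simp add: adg_avg_def degs_correct_def)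
  then show "0 \<le> adg_avg s"
    by (simp add: sum_nonneg)
  have "real (\<Sum>v\<in>?U. card (neighbors_in G ?U v)) \<le> real (2 * degeneracy G * card ?U)"
    using sum_card_neighbors_in_le[OF U] of_nat_mono by blast
  then show "adg_avg s \<le> 2 * real (degeneracy G)"
    unfolding avg using pos by (simp add: divide_le_eq)
qed

lemma adg_batch_nonempty:
  assumes "degs_correct s" "active s \<noteq> {}" "0 \<le> \<epsilon>"
  shows "adg_batch \<epsilon> s \<noteq> {}"
proof
  assume "adg_batch \<epsilon> s = {}"
  then have gt: "(1 + \<epsilon>) * adg_avg s < real_of_int (deg_of s v)" if "v \<in> active s" for v
    using that by (force simp: adg_batch_def)
  have fin: "finite (active s)"
    using assms finite_active by blast
  have "adg_avg s \<le> (1 + \<epsilon>) * adg_avg s"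
    using adg_avg_bounds(1)[OF assms(1,2)] assms(3) by (simp add: algebra_simps)
  \<comment> \<open>By definition of the average both sums are equal, so the strict inequality is
    absurd.\<close>
  then have "(\<Sum>v\<in>active s. adg_avg s) < (\<Sum>v\<in>active s. real_of_int (deg_of s v))"
    using gt fin assms(2) by (intro sum_strict_mono) (auto intro: le_less_trans)
  then show False
    using fin assms(2) by (simp add: adg_avg_def)
qed

lemma adg_batch_degree_le:
  assumes "degs_correct s" "v \<in> adg_batch \<epsilon> s" "0 \<le> \<epsilon>"
  shows "real (card (neighbors_in G (active s) v)) \<le> 2 * (1 + \<epsilon>) * real (degeneracy G)"
proof -
  have "v \<in> active s"
    using assms by (simp add: adg_batch_def)
  then have "real (card (neighbors_in G (active s) v)) \<le> (1 + \<epsilon>) * adg_avg s"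
    using assms by (auto simp: adg_batch_def degs_correct_def)
  also have "\<dots> \<le> (1 + \<epsilon>) * (2 * real (degeneracy G))"
    using adg_avg_bounds(2)[OF assms(1)] \<open>v \<in> active s\<close> assms(3)
    by (intro mult_left_mono) auto
  finally show ?thesis
    by (simp add: algebra_simps)
qed

section \<open>Preservation of the invariants\<close>

lemma active_adg_step: "active (adg_step \<epsilon> G s) = active s - adg_batch \<epsilon> s"
  by (simp add: adg_step_def Let_def)

lemma degs_correct_adg_init: "degs_correct (adg_init G)"
  by (simp add: degs_correct_def adg_init_def out_degree_eq_card_neighbors_in)

lemma degs_correct_adg_step:
  assumes "degs_correct s"
  shows "degs_correct (adg_step \<epsilon> G s)"
proof -
  let ?U = "active s" and ?R = "adg_batch \<epsilon> s"
  have RU: "?R \<subseteq> ?U" and U: "?U \<subseteq> verts G"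
    using assms by (auto simp: adg_batch_def degs_correct_def)
  have fin: "finite ?U"
    using assms finite_active by blast
  have "card (neighbors_in G ?U v) =
      card (neighbors_in G (?U - ?R) v) + card {w \<in> ?R. v \<in> neighbors_in G ?U w}"
    if "v \<in> ?U" for v
  proof -
    \<comment> \<open>By symmetry of adjacency, the batch vertices that decrement the counter of
      \<open>v\<close> are exactly its neighbors in the batch.\<close>
    have "neighbors_in G ?U v = neighbors_in G (?U - ?R) v \<union> {w \<in> ?R. v \<in> neighbors_in G ?U w}"
      using that RU dominates_commute[of v] by (auto simp: neighbors_in_def)
    moreover have "neighbors_in G (?U - ?R) v \<inter> {w \<in> ?R. v \<in> neighbors_in G ?U w} = {}"
      by (auto simp: neighbors_in_def)
    moreover have "finite ?R"
      using RU fin finite_subset by blast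
    ultimately show ?thesis
      using fin by (simp add: card_Un_disjoint finite_neighbors_in)
  qed
  then show ?thesis
    using assms U by (auto simp: degs_correct_def adg_step_def Let_def)
qed

lemma ranks_correct_adg_step:
  assumes "degs_correct s" "ranks_correct (2 * (1 + \<epsilon>) * real (degeneracy G)) s" "0 \<le> \<epsilon>"
  shows "ranks_correct (2 * (1 + \<epsilon>) * real (degeneracy G)) (adg_step \<epsilon> G s)"
proof -
  let ?U = "active s" and ?R = "adg_batch \<epsilon> s" and ?t = "adg_step \<epsilon> G s"
  let ?K = "2 * (1 + \<epsilon>) * real (degeneracy G)"
  have RU: "?R \<subseteq> ?U" and U: "?U \<subseteq> verts G"
    using assms by (auto simp: adg_batch_def degs_correct_def)
  have rank: "rank_of ?t v = (if v \<in> ?R then level s else rank_of s v)" for v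
    by (simp add: adg_step_def Let_def)
  \<comment> \<open>Earlier vertices rank strictly below the current batch, which receives
    \<open>level s\<close>.\<close>
  have old: "rank_of s v < level s" if "v \<in> verts G - ?U" for v
    using that assms(2) by (simp add: ranks_correct_def)
  have "rank_of ?t v < level ?t \<and>
     real (card {u \<in> neighbors_in G (verts G) v. u \<in> active ?t \<or> rank_of ?t v \<le> rank_of ?t u}) \<le> ?K"
    if v: "v \<in> verts G - active ?t" for v
  proof (cases "v \<in> ?R")
    case True
    \<comment> \<open>A vertex of \<open>?U\<close> stays active or ties with \<open>v\<close> at
      \<open>level s\<close>; any other vertex ranks lower by \<open>old\<close>.\<close>
    have "u \<in> active ?t \<or> rank_of ?t v \<le> rank_of ?t u \<longleftrightarrow> u \<in> ?U" if "u \<in> verts G" for u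
      using True RU old[of u] that by (cases "u \<in> ?U") (auto simp: rank active_adg_step)
    then have "{u \<in> neighbors_in G (verts G) v. u \<in> active ?t \<or> rank_of ?t v \<le> rank_of ?t u}
        = neighbors_in G ?U v"
      using U by (auto simp: neighbors_in_def)
    moreover have "rank_of ?t v < level ?t"
      using True by (simp add: adg_step_def Let_def)
    ultimately show ?thesis
      using adg_batch_degree_le[OF assms(1) True assms(3)] by simp
  next
    case False
    then have v': "v \<in> verts G - ?U"
      using v by (auto simp: active_adg_step)
    \<comment> \<open>Neighbors leaving the active set now receive \<open>level s\<close>, above the
      rank of \<open>v\<close>, so they stay in the counted set.\<close>
    have "{u \<in> neighbors_in G (verts G) v. u \<in> active ?t \<or> rank_of ?t v \<le> rank_of ?t u}
        = {u \<in> neighbors_in G (verts G) v. u \<in> ?U \<or> rank_of s v \<le> rank_of s u}"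
      using False RU old[OF v'] by (auto simp: rank active_adg_step)
    moreover have "rank_of ?t v < level ?t"
      using False old[OF v'] by (simp add: adg_step_def Let_def)
    ultimately show ?thesis
      using v' assms(2) by (simp add: ranks_correct_def)
  qed
  then show ?thesis
    by (simp add: ranks_correct_def)
qed

section \<open>Termination and the final ordering\<close>

lemma adg_terminates:
  assumes "0 \<le> \<epsilon>"
  shows "\<exists>t. while_option (\<lambda>s. active s \<noteq> {}) (adg_step \<epsilon> G) (adg_init G) = Some t"
proof (rule measure_while_option_Some[where P = degs_correct and f = "\<lambda>s. card (active s)"])
  fix s assume s: "degs_correct s" "active s \<noteq> {}"
  have "active s - adg_batch \<epsilon> s \<subset> active s"
    using adg_batch_nonempty[OF s assms] by (auto simp: adg_batch_def)
  moreover have "finite (active s)"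
    using s finite_active by blast
  ultimately show "degs_correct (adg_step \<epsilon> G s) \<and> card (active (adg_step \<epsilon> G s)) < card (active s)"
    using s by (simp add: degs_correct_adg_step active_adg_step psubset_card_mono)
qed (rule degs_correct_adg_init)

end

theorem lemma4:
  fixes \<epsilon> :: real and G :: "('a, 'b) pre_digraph"
  assumes "\<epsilon> \<ge> 0" and "graph G"
  shows "\<exists>\<rho>. adg \<epsilon> G = Some \<rho> \<and> partial_approx_degeneracy_ordering (2 * (1 + \<epsilon>)) G \<rho>"
proof -
  interpret graph G by fact
  let ?K = "2 * (1 + \<epsilon>) * real (degeneracy G)"
  obtain t where t: "while_option (\<lambda>s. active s \<noteq> {}) (adg_step \<epsilon> G) (adg_init G) = Some t"
    using adg_terminates[OF assms(1)] by blast
  \<comment> \<open>Vacuous: all vertices are still active, so the placeholder rank 0 is never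
    examined.\<close>
  have "ranks_correct ?K (adg_init G)"
    by (simp add: ranks_correct_def adg_init_def)
  then have "degs_correct t \<and> ranks_correct ?K t"
    using t assms(1) degs_correct_adg_init degs_correct_adg_step ranks_correct_adg_step
    by (intro while_option_rule[where P = "\<lambda>s. degs_correct s \<and> ranks_correct ?K s", OF _ t]) auto
  moreover have "active t = {}"
    using while_option_stop[OF t] by simp
  \<comment> \<open>With no active vertices left, the invariant covers all vertices and compares
    final ranks only.\<close>
  ultimately have "partial_approx_degeneracy_ordering (2 * (1 + \<epsilon>)) G (rank_of t)"
    by (simp add: ranks_correct_def partial_approx_degeneracy_ordering_def)
  then show ?thesis
    using t by (simp add: adg_def)
qed

end
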